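(* Let $F(x) = \sum_{j=0}^{r} a_{j} x^{d_{j}} \in \mathbb Z[x]$, where $0 = d_{0} < d_{1} < \cdots < d_{r}$ and $a_{r} a_{0} \ne 0$. Let $\varepsilon \in (0,1/4]$, let $k_{0}$ be a real number with $k_0\ge 2$, and set $\kappa = \lfloor 1/\varepsilon \rfloor + 1$. Suppose that \[ \deg F \ge \max \bigg\{ \frac{\kappa^{2N-2}}{2} \Big( \varepsilon - \frac{1}{\kappa} \Big)^{-1}, \ k_{0} \big( \kappa^{N-1} + \varepsilon \big) \bigg\}, \quad \text{where } N = 2\,\Vert F \Vert^{2} + 2 r - 5. \] If the non-reciprocal part of $F(x)$ is reducible in $\mathbb Z[x]$, then there exists an integer $k$ in the interval $[k_{0}, (\deg F)/(1-\varepsilon))$ such that: (i) for each $j \in \{0,1,\dots,r\}$, the number $d_{j} \bmod k$ lies in $[0,\varepsilon k) \cup ((1-\varepsilon) k,k)$; (ii) if $\overline{d}_{j}$ and $\ell_{j}$ (for $0\le j\le r$) are defined by $\overline{d}_{j} = (d_{j} + \lfloor \varepsilon k \rfloor) \bmod k$ and $d_{j} + \lfloor \varepsilon k \rfloor = k \ell_{j} + \overline{d}_{j}$, and $G(x,y) = \sum_{j=0}^{r} a_{j} x^{\overline{d}_{j}} y^{\ell_{j}}$, then $x^{-M} G(x,y)$ is reducible in $\mathbb Z[x,y]$, where $M$ is the largest non-negative integer such that $x^{-M} G(x,y) \in \mathbb Z[x,y]$.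
   Context: For integers $a$ and $k\ge1$, $a \bmod k$ denotes the unique integer $b\in[0,k)$ with $a\equiv b \pmod k$. $\Vert F\Vert$ denotes the Euclidean norm of the coefficient vector of $F$ (square root of the sum of squares of the coefficients). For nonzero $f(x)\in\mathbb Q[x]$, its reciprocal is $\tilde f(x)=x^{\deg f}f(1/x)$, and $f$ is reciprocal if $f=\pm\tilde f$. The non-reciprocal part of a nonzero $f(x)\in\mathbb Z[x]$ is $f(x)$ with every irreducible reciprocal factor in $\mathbb Z[x]$ having positive leading coefficient removed, to the full multiplicity with which it divides $f$. *)

theory Defs
  imports Complex_Main "HOL-Computational_Algebra.Computational_Algebra"
begin

definition poly_norm :: "int poly \<Rightarrow> real" where
  "poly_norm f = sqrt (\<Sum>i\<le>degree f. (real_of_int (coeff f i))\<^sup>2)"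

text \<open>The library function \<^const>\<open>reflect_poly\<close> sends \<open>f\<close> to \<open>x ^ deg f * f (1/x)\<close>, also
  when \<open>f\<close> vanishes at \<open>0\<close>.\<close>

definition reciprocal_poly :: "int poly \<Rightarrow> bool" where
  "reciprocal_poly f \<longleftrightarrow> f = reflect_poly f \<or> f = - reflect_poly f"

text \<open>The constant polynomials given by prime numbers are irreducible in \<open>\<int>[x]\<close> and reciprocal,
  so they are removed as well; the division is exact. Meaningful for \<open>f \<noteq> 0\<close> only.\<close>

definition nonreciprocal_part :: "int poly \<Rightarrow> int poly" where
  "nonreciprocal_part f =
     f div (\<Prod>p | irreducible p \<and> reciprocal_poly p \<and> lead_coeff p > 0 \<and> p dvd f. p ^ multiplicity p f)"

text \<open>Zero and units (here \<open>1\<close> and \<open>-1\<close>) are neither irreducible nor reducible.\<close>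

definition reducible :: "'a::comm_semiring_1 \<Rightarrow> bool" where
  "reducible f \<longleftrightarrow> f \<noteq> 0 \<and> \<not> f dvd 1 \<and> \<not> irreducible f"

text \<open>\<open>\<int>[x,y]\<close> is rendered as \<open>(\<int>[x])[y]\<close>, so the inner variable is \<open>x\<close> and the outer
  one is \<open>y\<close>.\<close>

definition monom_xy :: "int \<Rightarrow> nat \<Rightarrow> nat \<Rightarrow> int poly poly" where
  "monom_xy c i j = monom (monom c i) j"

text \<open>\<open>strip_x G\<close> is \<open>x ^ (-M) * G\<close> with \<open>M\<close> maximal such that this is a polynomial.
  The maximum exists for \<open>G \<noteq> 0\<close>.\<close>

definition strip_x :: "int poly poly \<Rightarrow> int poly poly" where
  "strip_x G = (let M = (GREATEST m. monom_xy 1 m 0 dvd G) in G div monom_xy 1 M 0)"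

end

(* If the non-reciprocal part of F is reducible, then F = R u v with R reciprocal and u, v
   non-reciprocal, and W = R u v~ (where ~ denotes the reciprocal) satisfies W W~ = F F~ although
   W is none of F, -F, F~, -F~. Comparing middle coefficients, W has the same norm as F, so it has
   few terms. Dirichlet's theorem then yields k such that all exponents of F and of W are close to
   multiples of k. Writing y for x^k after a shift by floor(epsilon k), the identity F F~ = W W~
   lifts to Z[x,y] without carries, because epsilon <= 1/4. If the lift of F stripped of powers of
   x were irreducible, hence prime, it would divide the lift of W or of W~; setting y = x^k,
   F would divide W or W~, which forces W to be one of the four excluded polynomials. *)

theory Submission
  imports Defs "HOL-Analysis.Kronecker_Approximation_Theorem"
begin

section \<open>Arithmetic of reciprocal polynomials over the integers\<close>

lemma reciprocal_poly_mult:
  "reciprocal_poly p \<Longrightarrow> reciprocal_poly q \<Longrightarrow> reciprocal_poly (p * q)"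
  unfolding reciprocal_poly_def reflect_poly_mult
  by (metis minus_mult_left minus_mult_right minus_minus)

lemma reciprocal_poly_1: "reciprocal_poly 1"
  by (simp add: reciprocal_poly_def)

lemma reciprocal_poly_power: "reciprocal_poly p \<Longrightarrow> reciprocal_poly (p ^ n)"
  by (induction n) (simp_all add: reciprocal_poly_mult reciprocal_poly_1)

lemma reciprocal_poly_prod:
  "(\<And>x. x \<in> A \<Longrightarrow> reciprocal_poly (f x)) \<Longrightarrow> reciprocal_poly (\<Prod>x\<in>A. f x)"
  by (induction A rule: infinite_finite_induct)
     (simp_all add: reciprocal_poly_mult reciprocal_poly_1)

lemma reciprocal_poly_minus: "reciprocal_poly (- p) \<longleftrightarrow> reciprocal_poly p"
proof -
  have "reflect_poly (- p) = - reflect_poly p"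
    using reflect_poly_smult[of "-1" p] by simp
  then show ?thesis unfolding reciprocal_poly_def by auto
qed

lemma reciprocal_poly_mult_cancel:
  assumes "reciprocal_poly (p * q)" "reciprocal_poly p" "p \<noteq> 0"
  shows "reciprocal_poly q"
proof -
  obtain s where s: "s = 1 \<or> s = -1" "reflect_poly (p * q) = s * (p * q)"
    using assms(1) unfolding reciprocal_poly_def
    by (metis mult_1 mult_minus1 minus_minus)
  obtain t where t: "t = 1 \<or> t = -1" "reflect_poly p = t * p"
    using assms(2) unfolding reciprocal_poly_def
    by (metis mult_1 mult_minus1 minus_minus)
  have "p * (t * reflect_poly q) = p * (s * q)"
    using s(2) t(2) by (simp add: reflect_poly_mult algebra_simps)
  then have "t * reflect_poly q = s * q" using assms(3) by simp
  then show ?thesis using s(1) t(1) unfolding reciprocal_poly_def by auto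
qed

text \<open>Writing \<open>p~\<close> for the reciprocal, \<open>p^2 = (p~)^2\<close> gives
  \<open>p = p~\<close> or \<open>p = -p~\<close>. The case \<open>p^2 = -(p~)^2\<close> forces
  \<open>p = 0\<close>, because the leading coefficients of both squares are nonnegative.\<close>

lemma reciprocal_poly_square_imp:
  assumes "reciprocal_poly (p * p)"
  shows "reciprocal_poly p"
proof -
  consider "p * p = reflect_poly p * reflect_poly p" | "p * p = - (reflect_poly p * reflect_poly p)"
    using assms unfolding reciprocal_poly_def reflect_poly_mult by blast
  then show ?thesis
  proof cases
    case 1
    then show ?thesis by (simp add: square_eq_iff reciprocal_poly_def)
  next
    case 2
    then have "lead_coeff (p * p) = lead_coeff (- (reflect_poly p * reflect_poly p))" by simp
    then have "lead_coeff p * lead_coeff p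
        = - (lead_coeff (reflect_poly p) * lead_coeff (reflect_poly p))"
      by (simp only: lead_coeff_mult lead_coeff_minus)
    moreover have "lead_coeff p * lead_coeff p \<ge> 0"
      "lead_coeff (reflect_poly p) * lead_coeff (reflect_poly p) \<ge> 0" by simp_all
    ultimately have "lead_coeff p * lead_coeff p = 0" by linarith
    then show ?thesis by (simp add: reciprocal_poly_def)
  qed
qed

lemma dvd_same_degree_constE:
  fixes p q :: "'a :: idom poly"
  assumes "p dvd q" "degree q = degree p" "q \<noteq> 0"
  obtains c where "q = smult c p"
proof -
  obtain s where s: "q = p * s" using assms(1) by blast
  then have "degree s = 0" using assms by (simp add: degree_mult_eq)
  then obtain c where "s = [:c:]" by (rule degree_eq_zeroE)
  then show ?thesis using s that by simp
qed

text \<open>A nonzero constant term makes \<open>p\<close> and its reciprocal equal in degree, so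
  the quotient is a constant \<open>c\<close>. Reflecting a second time gives
  \<open>c * c = 1\<close>.\<close>

lemma dvd_reflect_poly_imp_reciprocal:
  fixes p :: "int poly"
  assumes "p dvd reflect_poly p" "coeff p 0 \<noteq> 0"
  shows "reciprocal_poly p"
proof -
  have nz: "p \<noteq> 0" using assms(2) by auto
  obtain c where c: "reflect_poly p = smult c p"
    using dvd_same_degree_constE[OF assms(1)] assms(2) nz by auto
  have "p = reflect_poly (smult c p)" using c assms(2) by (metis reflect_poly_reflect_poly)
  also have "\<dots> = smult (c * c) p" by (simp add: reflect_poly_smult c)
  finally have "lead_coeff p = c * c * lead_coeff p" by (metis lead_coeff_smult)
  then have "c * c = 1" using nz by simp
  then have "c = 1 \<or> c = -1" by (simp add: square_eq_1_iff)
  then show ?thesis using c by (auto simp: reciprocal_poly_def)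
qed

section \<open>The non-reciprocal part and the companion polynomial \<open>W\<close>\<close>

text \<open>Start from \<open>P = p * v\<close> with \<open>p\<close> prime. If \<open>v\<close> is
  reciprocal, move a second prime \<open>q\<close> from \<open>v\<close> to \<open>p\<close>. This
  fails only if \<open>p * q\<close> is reciprocal, and then \<open>p\<close> also divides
  \<open>v\<close>, so that \<open>p * p\<close> can be split off instead.\<close>

lemma nonreciprocal_splitE:
  fixes P :: "int poly"
  assumes red: "reducible P" and P0: "coeff P 0 \<noteq> 0"
    and nonrec: "\<And>q. irreducible q \<Longrightarrow> q dvd P \<Longrightarrow> \<not> reciprocal_poly q"
  obtains u v where "P = u * v" "\<not> reciprocal_poly u" "\<not> reciprocal_poly v"
proof -
  have P: "P \<noteq> 0" "\<not> is_unit P" "\<not> irreducible P" using red by (auto simp: reducible_def)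
  obtain p where p: "p dvd P" "prime p" using prime_divisor_exists[OF P(1,2)] by blast
  obtain v where v: "P = p * v" using p(1) by blast
  have irr_p: "irreducible p" using p(2) by (simp add: prime_elem_imp_irreducible)
  have nrp: "\<not> reciprocal_poly p" using nonrec irr_p p(1) by blast
  have pv0: "coeff p 0 \<noteq> 0" "coeff v 0 \<noteq> 0" using P0 v by (auto simp: coeff_mult)
  have nz: "p \<noteq> 0" "v \<noteq> 0" using P(1) v by auto
  have nu: "\<not> is_unit v"
    using P(3) v irr_p by (metis dvd_refl irreducible_mult_unit_left mult.commute)
  show ?thesis
  proof (cases "reciprocal_poly v")
    case False
    then show ?thesis using that v nrp by blast
  next
    case rv: True
    obtain q where q: "q dvd v" "prime q" using prime_divisor_exists[OF nz(2) nu] by blast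
    obtain v' where v': "v = q * v'" using q(1) by blast
    have nrq: "\<not> reciprocal_poly q"
      using nonrec q v by (simp add: prime_elem_imp_irreducible)
    have "v' \<noteq> 0" using nz(2) v' by auto
    then have nrv': "\<not> reciprocal_poly v'"
      using rv nrq reciprocal_poly_mult_cancel[of v' q] v' by (auto simp: mult.commute)
    show ?thesis
    proof (cases "reciprocal_poly (p * q)")
      case False
      then show ?thesis using that[of "p * q" v'] nrv' v v' by (simp add: mult.assoc)
    next
      case True
      \<comment> \<open>The prime \<open>p\<close> cannot divide its own reciprocal, so it divides
        that of \<open>q\<close>, hence that of \<open>v\<close>, which is \<open>v\<close> up to
        sign.\<close>
      then have "p dvd reflect_poly p * reflect_poly q"
        unfolding reciprocal_poly_def reflect_poly_mult
        by (metis dvd_minus_iff dvd_triv_left)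
      then have "p dvd reflect_poly q"
        using p(2) dvd_reflect_poly_imp_reciprocal[of p] nrp pv0 by (auto simp: prime_dvd_mult_iff)
      then have "p dvd reflect_poly v" by (simp add: v' reflect_poly_mult)
      then have "p dvd v" using rv unfolding reciprocal_poly_def by (metis dvd_minus_iff)
      then obtain w where w: "v = p * w" by blast
      have "w \<noteq> 0" using nz(2) w by auto
      then have "\<not> reciprocal_poly w"
        using rv nrp reciprocal_poly_mult_cancel[of w p] w by (auto simp: mult.commute)
      moreover have "\<not> reciprocal_poly (p * p)" using nrp reciprocal_poly_square_imp by blast
      ultimately show ?thesis using that[of "p * p" w] v w by (simp add: mult.assoc)
    qed
  qed
qed

text \<open>Powers of distinct primes are coprime, so the divisor in the definition of
  \<open>nonreciprocal_part\<close> really divides \<open>F\<close>. A reciprocal irreducible factor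
  left in the quotient would exceed its own multiplicity in \<open>F\<close>.\<close>

lemma nonreciprocal_part_factorE:
  assumes "F \<noteq> 0"
  obtains R where "F = R * nonreciprocal_part F" "reciprocal_poly R"
    "\<And>q. irreducible q \<Longrightarrow> q dvd nonreciprocal_part F \<Longrightarrow> \<not> reciprocal_poly q"
proof -
  define A where "A = {p. irreducible p \<and> reciprocal_poly p \<and> lead_coeff p > 0 \<and> p dvd F}"
  define R where "R = (\<Prod>p\<in>A. p ^ multiplicity p F)"
  have AF: "A \<subseteq> prime_factors F"
  proof
    fix p assume p: "p \<in> A"
    \<comment> \<open>The positive leading coefficient picks one of \<open>p\<close> and
      \<open>-p\<close>, so distinct members of \<open>A\<close> are non-associated primes.\<close>
    then have "normalize p = p" by (simp add: A_def normalize_poly_def flip: one_pCons)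
    then have "prime p" using p by (simp add: A_def prime_def irreducible_imp_prime_elem)
    then show "p \<in> prime_factors F" using p assms by (intro prime_factorsI) (auto simp: A_def)
  qed
  have finA: "finite A" using AF finite_subset by blast
  have "(\<Prod>p\<in>B. p ^ multiplicity p F) dvd F" if "finite B" "B \<subseteq> A" for B
    using that
  proof (induction B rule: finite_induct)
    case empty
    then show ?case by simp
  next
    case (insert p B)
    have "coprime p q" if "q \<in> B" for q
      using that insert.hyps insert.prems AF by (intro primes_coprime) auto
    then have "coprime (p ^ multiplicity p F) (\<Prod>p\<in>B. p ^ multiplicity p F)"
      by (intro prod_coprime_right) simp
    then show ?case
      using insert by (simp add: divides_mult multiplicity_dvd)
  qed
  then have RF: "R dvd F" unfolding R_def using finA by blast
  have F: "F = R * nonreciprocal_part F"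
    using RF by (simp add: nonreciprocal_part_def R_def A_def)
  have "\<not> reciprocal_poly q" if q: "irreducible q" "q dvd nonreciprocal_part F" for q
  proof
    assume rq: "reciprocal_poly q"
    obtain p where p: "p = q \<or> p = - q" "lead_coeff p > 0"
      using q(1) by (metis irreducible_def lead_coeff_minus leading_coeff_0_iff neg_0_less_iff_less
          linorder_neqE)
    have ip: "irreducible p" using p(1) q(1) irreducible_mult_unit_left[of "-1" q] by auto
    have pd: "p dvd nonreciprocal_part F" using p(1) q(2) by auto
    have "p dvd F" using pd F by (metis dvd_mult)
    then have pA: "p \<in> A"
      unfolding A_def using ip p rq reciprocal_poly_minus by auto
    have "p ^ multiplicity p F dvd R" unfolding R_def using finA pA by (rule dvd_prodI)
    then have "p ^ multiplicity p F * p dvd R * nonreciprocal_part F" using pd by (rule mult_dvd_mono)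
    then have "p ^ Suc (multiplicity p F) dvd F" by (simp only: flip: F power_Suc2)
    moreover have "\<not> is_unit p" using ip by (simp add: irreducible_def)
    ultimately show False using multiplicity_geI[OF assms] not_less_eq_eq by blast
  qed
  moreover have "reciprocal_poly R"
    unfolding R_def by (intro reciprocal_poly_prod reciprocal_poly_power) (simp add: A_def)
  ultimately show ?thesis using that F by blast
qed

text \<open>Replacing the factor \<open>v\<close> of \<open>F = R * (u * v)\<close> by its
  reciprocal preserves the product with the reflection, since nonzero constant terms make reflection
  an involution. \<open>W\<close> equal to \<open>F\<close> up to sign would make \<open>v\<close>
  reciprocal; \<open>W\<close> equal to \<open>reflect_poly F\<close> up to sign would make
  \<open>u\<close> reciprocal.\<close>

lemma reducible_nonreciprocal_part_imp_companion:
  fixes F :: "int poly"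
  assumes F0: "coeff F 0 \<noteq> 0" and red: "reducible (nonreciprocal_part F)"
  obtains W where "W * reflect_poly W = F * reflect_poly F" "coeff W 0 \<noteq> 0" "degree W = degree F"
    "W \<noteq> F" "W \<noteq> - F" "W \<noteq> reflect_poly F" "W \<noteq> - reflect_poly F"
proof -
  have "F \<noteq> 0" using F0 by auto
  then obtain R where R: "F = R * nonreciprocal_part F" "reciprocal_poly R"
    "\<And>q. irreducible q \<Longrightarrow> q dvd nonreciprocal_part F \<Longrightarrow> \<not> reciprocal_poly q"
    by (rule nonreciprocal_part_factorE) blast
  have P0: "coeff (nonreciprocal_part F) 0 \<noteq> 0"
    using F0 R(1) by (metis coeff_mult_0 mult_zero_right)
  obtain u v where uv: "nonreciprocal_part F = u * v" "\<not> reciprocal_poly u" "\<not> reciprocal_poly v"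
    using nonreciprocal_splitE[OF red P0 R(3)] by blast
  have F: "F = R * (u * v)" using R(1) uv(1) by simp
  have nz: "R \<noteq> 0" "u \<noteq> 0" "v \<noteq> 0" and c0: "coeff R 0 \<noteq> 0" "coeff u 0 \<noteq> 0" "coeff v 0 \<noteq> 0"
    using F0 F by (auto simp: coeff_mult_0)
  define W where "W = R * (u * reflect_poly v)"
  have rR: "reflect_poly R = R \<or> reflect_poly R = - R" using R(2) by (auto simp: reciprocal_poly_def)
  show ?thesis
  proof
    show "W * reflect_poly W = F * reflect_poly F"
      using c0 by (simp add: W_def F reflect_poly_mult)
    show "coeff W 0 \<noteq> 0" using c0 nz by (simp add: W_def coeff_mult_0)
    show "degree W = degree F" using nz c0 by (simp add: W_def F degree_mult_eq)
    have v: "reflect_poly v \<noteq> v" "reflect_poly v \<noteq> - v" "reflect_poly u \<noteq> u" "reflect_poly u \<noteq> - u"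
      using uv by (auto simp: reciprocal_poly_def)
    have WF: "W = s * F \<longleftrightarrow> reflect_poly v = s * v" for s
      using nz unfolding W_def F by (metis mult.assoc mult.left_commute mult_left_cancel)
    show "W \<noteq> F" "W \<noteq> - F" using WF[of 1] WF[of "-1"] v by auto
    have refl: "reflect_poly F = reflect_poly R * (reflect_poly u * reflect_poly v)"
      by (simp add: F reflect_poly_mult)
    have "W = s * (R * (reflect_poly u * reflect_poly v)) \<longleftrightarrow> u = s * reflect_poly u" for s
    proof -
      have "W = s * (R * (reflect_poly u * reflect_poly v))
        \<longleftrightarrow> (R * reflect_poly v) * u = (R * reflect_poly v) * (s * reflect_poly u)"
        by (simp add: W_def algebra_simps)
      also have "\<dots> \<longleftrightarrow> u = s * reflect_poly u" using nz by simp
      finally show ?thesis .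
    qed
    from this[of 1] this[of "-1"]
    have "W \<noteq> R * (reflect_poly u * reflect_poly v)" "W \<noteq> - (R * (reflect_poly u * reflect_poly v))"
      using v(3,4) by (auto simp: minus_equation_iff[of u])
    then show "W \<noteq> reflect_poly F" "W \<noteq> - reflect_poly F"
      using rR unfolding refl by auto
  qed
qed

section \<open>The norm and the number of terms\<close>

text \<open>This reads the squared norm off the product with the reflection, so it passes from
  \<open>F\<close> to any \<open>W\<close> of the same degree with the same product.\<close>

lemma coeff_mult_reflect_poly_degree:
  fixes f :: "'a :: comm_semiring_1 poly"
  shows "coeff (f * reflect_poly f) (degree f) = (\<Sum>i\<le>degree f. (coeff f i)\<^sup>2)"
proof -
  have "(if degree f < degree f - i then 0 else coeff f (degree f - (degree f - i))) = coeff f i"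
    if "i \<le> degree f" for i using that by auto
  then show ?thesis by (simp add: coeff_mult coeff_reflect_poly power2_eq_square)
qed

lemma poly_norm_square_eq: "(poly_norm f)\<^sup>2 = of_int (\<Sum>i\<le>degree f. (coeff f i)\<^sup>2)"
  by (simp add: poly_norm_def sum_nonneg)

lemma card_support_le_sum_squares:
  fixes f :: "int poly"
  shows "int (card {i. i \<le> degree f \<and> coeff f i \<noteq> 0}) \<le> (\<Sum>i\<le>degree f. (coeff f i)\<^sup>2)"
proof -
  have "int (card {i. i \<le> degree f \<and> coeff f i \<noteq> 0})
      = (\<Sum>i\<in>{i. i \<le> degree f \<and> coeff f i \<noteq> 0}. 1)" by simp
  also have "\<dots> \<le> (\<Sum>i\<in>{i. i \<le> degree f \<and> coeff f i \<noteq> 0}. (coeff f i)\<^sup>2)"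
  proof (rule sum_mono)
    fix i assume "i \<in> {i. i \<le> degree f \<and> coeff f i \<noteq> 0}"
    then have "0 < (coeff f i)\<^sup>2" by simp
    then show "1 \<le> (coeff f i)\<^sup>2" by linarith
  qed
  also have "\<dots> \<le> (\<Sum>i\<le>degree f. (coeff f i)\<^sup>2)" by (intro sum_mono2) auto
  finally show ?thesis .
qed

section \<open>The substitution of \<open>x^k\<close> for \<open>y\<close>, and powers of
  \<open>x\<close>\<close>

text \<open>With all \<open>x\<close>-degrees below \<open>k\<close>, the substituted blocks do not
  overlap: the coefficients of \<open>P\<close> act as digits in base \<open>x^k\<close>, with no
  carries.\<close>

lemma coeff_poly_monom_small_degree:
  fixes P :: "'a :: comm_ring_1 poly poly"
  assumes "\<And>v. degree (coeff P v) < k" "u < k"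
  shows "coeff (poly P (monom 1 k)) (k * v + u) = coeff (coeff P v) u"
  using assms
proof (induction P arbitrary: v)
  case 0
  then show ?case by simp
next
  case (pCons c P)
  have c: "degree c < k" using pCons.prems(1)[of 0] by simp
  have IH: "coeff (poly P (monom 1 k)) (k * v + u) = coeff (coeff P v) u" for v
    using pCons.IH pCons.prems(1)[of "Suc _"] pCons.prems(2) by simp
  show ?case
  proof (cases v)
    case 0
    then show ?thesis using pCons.prems by (simp add: coeff_monom_mult)
  next
    case (Suc w)
    then have "degree c < k * v + u" using c by simp
    then have "coeff c (k * v + u) = 0" by (rule coeff_eq_0)
    moreover have "k * v + u - k = k * w + u" using Suc by simp
    ultimately show ?thesis using Suc IH[of w] by (simp add: coeff_monom_mult)
  qed
qed

lemma poly_monom_eq_0_imp_eq_0: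
  fixes P :: "'a :: comm_ring_1 poly poly"
  assumes "\<And>v. degree (coeff P v) < k" "poly P (monom 1 k) = 0"
  shows "P = 0"
proof (intro poly_eqI)
  fix v u
  show "coeff (coeff P v) u = coeff (coeff 0 v) u"
  proof (cases "u < k")
    case True
    then show ?thesis using coeff_poly_monom_small_degree[OF assms(1) True, of v] assms(2) by simp
  next
    case False
    then have "degree (coeff P v) < u" using assms(1)[of v] by linarith
    then show ?thesis by (simp add: coeff_eq_0)
  qed
qed

lemma degree_coeff_mult_less:
  fixes P Q :: "'a :: comm_ring_1 poly poly"
  assumes "\<And>v. 2 * degree (coeff P v) < k" "\<And>v. 2 * degree (coeff Q v) < k"
  shows "degree (coeff (P * Q) v) < k"
  unfolding coeff_mult
proof (rule degree_sum_less)
  fix i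
  have "degree (coeff P i * coeff Q (v - i)) \<le> degree (coeff P i) + degree (coeff Q (v - i))"
    by (rule degree_mult_le)
  then show "degree (coeff P i * coeff Q (v - i)) < k"
    using assms(1)[of i] assms(2)[of "v - i"] by linarith
next
  show "0 < k" using assms(1)[of 0] by simp
qed

lemma poly_monom_xy: "poly (monom_xy c i l) (monom 1 k) = monom c (i + k * l)"
  by (simp add: monom_xy_def poly_monom monom_power mult_monom mult.commute)

lemma degree_coeff_sum_monom_xy:
  assumes "\<And>j. j \<in> I \<Longrightarrow> 2 * u j < k" "0 < k"
  shows "2 * degree (coeff (\<Sum>j\<in>I. monom_xy (a j) (u j) (v j)) w) < k"
proof -
  have "degree (coeff (monom_xy (a j) (u j) (v j)) w) \<le> u j" for j
    by (simp add: monom_xy_def degree_monom_le)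
  \<comment> \<open>For naturals, \<open>2 * u < k\<close> is the same as
    \<open>u < (k + 1) div 2\<close>, the form of a strict bound that \<open>degree_sum_less\<close>
    accepts.\<close>
  then have "degree (coeff (\<Sum>j\<in>I. monom_xy (a j) (u j) (v j)) w) < (k + 1) div 2"
    unfolding coeff_sum using assms
    by (intro degree_sum_less)
       (force intro: le_less_trans[of "degree _" "u _"], simp)
  then show ?thesis by linarith
qed

text \<open>As \<open>f\<close> does not vanish at 0, the constant term of the quotient must, so one
  factor \<open>x\<close> at a time can be cancelled.\<close>

lemma dvd_monom_mult_cancel:
  fixes f g :: "'a :: idom poly"
  assumes "f dvd monom 1 m * g" "coeff f 0 \<noteq> 0"
  shows "f dvd g"
  using assms(1)
proof (induction m)
  case 0
  then show ?case by simp
next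
  case (Suc m)
  then obtain q where q: "pCons 0 (monom 1 m * g) = f * q"
    by (metis dvdE monom_Suc mult_pCons_left add.left_neutral smult_0_left)
  then have "coeff f 0 * coeff q 0 = 0" by (metis coeff_mult_0 coeff_pCons_0)
  then have "coeff q 0 = 0" using assms(2) by simp
  then obtain q' where "q = pCons 0 q'" by (cases q) auto
  then have "monom 1 m * g = f * q'" using q by simp
  then show ?case using Suc.IH by simp
qed

text \<open>The \<open>GREATEST\<close> in \<open>strip_x\<close> is attained, because the
  \<open>x\<close>-degree of any nonzero coefficient of \<open>G\<close> bounds the possible
  exponents.\<close>

lemma strip_xE:
  assumes "G \<noteq> 0"
  obtains M where "G = monom_xy 1 M 0 * strip_x G"
proof -
  obtain v where v: "coeff G v \<noteq> 0" using assms by (metis leading_coeff_0_iff)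
  have bound: "m \<le> degree (coeff G v)" if "monom_xy 1 m 0 dvd G" for m
  proof -
    have "monom 1 m dvd coeff G v"
      using that by (simp add: monom_xy_def monom_0 const_poly_dvd_iff)
    then show ?thesis using v dvd_imp_degree_le[of "monom 1 m" "coeff G v"] by (simp add: degree_monom_eq)
  qed
  have "monom_xy 1 0 0 dvd G" by (simp add: monom_xy_def monom_0 flip: one_pCons)
  then have "monom_xy 1 (GREATEST m. monom_xy 1 m 0 dvd G) 0 dvd G"
    using bound by (rule GreatestI_nat)
  then have "G = monom_xy 1 (GREATEST m. monom_xy 1 m 0 dvd G) 0 * strip_x G"
    unfolding strip_x_def Let_def by (rule dvd_mult_div_cancel[symmetric])
  then show ?thesis by (rule that)
qed

section \<open>Lifting univariate polynomials and their reflections to two variables\<close>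

lemma reflect_poly_sum_monom:
  assumes f: "f = (\<Sum>j\<in>I. monom (a j) (d j))" and d: "\<And>j. j \<in> I \<Longrightarrow> d j \<le> degree f"
  shows "reflect_poly f = (\<Sum>j\<in>I. monom (a j) (degree f - d j))"
proof (rule poly_eqI)
  fix i
  have "coeff f (degree f - i) = (\<Sum>j\<in>I. if d j = degree f - i then a j else 0)"
    by (subst f) (simp add: coeff_sum)
  moreover have "coeff (\<Sum>j\<in>I. monom (a j) (degree f - d j)) i
      = (\<Sum>j\<in>I. if degree f - d j = i then a j else 0)"
    by (simp add: coeff_sum)
  moreover have "\<dots> = (if i > degree f then 0 else (\<Sum>j\<in>I. if d j = degree f - i then a j else 0))"
  proof (cases "i > degree f")
    case True
    then show ?thesis by (simp, intro sum.neutral) auto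
  next
    case False
    then show ?thesis using d by (simp, intro sum.cong) fastforce+
  qed
  ultimately show "coeff (reflect_poly f) i = coeff (\<Sum>j\<in>I. monom (a j) (degree f - d j)) i"
    by (simp add: coeff_reflect_poly)
qed

text \<open>\<open>lift_xy\<close> is \<open>x ^ E * f\<close> with \<open>x ^ k\<close> renamed to \<open>y\<close>, where \<open>f = (\<Sum>j\<in>I. a j * x ^ d j)\<close>,
  and \<open>colift_xy\<close> is \<open>x ^ (2 E) * y ^ L\<close> times the same polynomial at \<open>(1 / x, 1 / y)\<close>.\<close>

definition lift_xy :: "nat \<Rightarrow> nat \<Rightarrow> ('b \<Rightarrow> int) \<Rightarrow> ('b \<Rightarrow> nat) \<Rightarrow> 'b set \<Rightarrow> int poly poly" where
  "lift_xy k E a d I = (\<Sum>j\<in>I. monom_xy (a j) ((d j + E) mod k) ((d j + E) div k))"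

definition colift_xy ::
    "nat \<Rightarrow> nat \<Rightarrow> nat \<Rightarrow> ('b \<Rightarrow> int) \<Rightarrow> ('b \<Rightarrow> nat) \<Rightarrow> 'b set \<Rightarrow> int poly poly" where
  "colift_xy k E L a d I =
     (\<Sum>j\<in>I. monom_xy (a j) (2 * E - (d j + E) mod k) (L - (d j + E) div k))"

text \<open>The conditions say in turn that the subtraction \<open>2 * E - (m + E) mod k\<close> is
  not truncated and that the \<open>x\<close>-exponents in the lift and in the colift stay below
  \<open>k / 2\<close>, so that a product of two such polynomials has \<open>x\<close>-degree below
  \<open>k\<close>.\<close>

definition near_multiple :: "nat \<Rightarrow> nat \<Rightarrow> nat \<Rightarrow> bool" where
  "near_multiple k E m \<longleftrightarrow> (m + E) mod k \<le> 2 * E \<and> 2 * ((m + E) mod k) < k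
     \<and> 2 * (2 * E - (m + E) mod k) < k"

lemma poly_lift_xy:
  "poly (lift_xy k E a d I) (monom 1 k) = monom 1 E * (\<Sum>j\<in>I. monom (a j) (d j))"
  by (simp add: lift_xy_def poly_sum poly_monom_xy sum_distrib_left mult_monom add.commute)

lemma poly_colift_xy:
  assumes f: "f = (\<Sum>j\<in>I. monom (a j) (d j))" and d: "\<And>j. j \<in> I \<Longrightarrow> d j \<le> degree f"
    and near: "\<And>j. j \<in> I \<Longrightarrow> near_multiple k E (d j)"
    and near_deg: "near_multiple k E (degree f)" and L: "L = (degree f + E) div k"
  shows "poly (colift_xy k E L a d I) (monom 1 k) = monom 1 (E + k * L - degree f) * reflect_poly f"
proof -
  have mod_div: "m + E = k * ((m + E) div k) + (m + E) mod k" for m by simp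
  have n: "degree f \<le> E + k * L"
    using mod_div[of "degree f"] near_deg unfolding L near_multiple_def by linarith
  \<comment> \<open>Both sides equal \<open>E + k * L - d j\<close>; the bounds on the residues and
    on \<open>d j\<close> ensure that no natural subtraction truncates.\<close>
  have "2 * E - (d j + E) mod k + k * (L - (d j + E) div k) = E + k * L - degree f + (degree f - d j)"
    if j: "j \<in> I" for j
  proof -
    have "(d j + E) div k \<le> L" unfolding L using d[OF j] by (intro div_le_mono) simp
    then have "k * ((d j + E) div k) \<le> k * L" by simp
    then show ?thesis using mod_div[of "d j"] near[OF j] n d[OF j]
      unfolding near_multiple_def by (simp only: diff_mult_distrib2) linarith
  qed
  moreover have "reflect_poly f = (\<Sum>j\<in>I. monom (a j) (degree f - d j))"
    using f d by (rule reflect_poly_sum_monom)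
  ultimately show ?thesis
    unfolding colift_xy_def
    by (simp add: poly_sum poly_monom_xy sum_distrib_left mult_monom cong: sum.cong)
qed

lemma degree_coeff_lift_xy:
  assumes "\<And>j. j \<in> I \<Longrightarrow> near_multiple k E (d j)" "0 < k"
  shows "2 * degree (coeff (lift_xy k E a d I) v) < k"
    and "2 * degree (coeff (colift_xy k E L a d I) v) < k"
  unfolding lift_xy_def colift_xy_def
  using assms by (intro degree_coeff_sum_monom_xy; simp add: near_multiple_def)+

text \<open>Scaling by \<open>c\<close> multiplies the product by \<open>c * c\<close>, so comparing
  leading coefficients leaves only \<open>c = 1\<close> and \<open>c = -1\<close>.\<close>

lemma reciprocal_product_smult_imp:
  fixes f g :: "int poly"
  assumes "g * reflect_poly g = f * reflect_poly f" "g = smult c f" "f \<noteq> 0"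
  shows "g = f \<or> g = - f"
proof -
  have "smult (c * c) (f * reflect_poly f) = f * reflect_poly f"
    using assms(1) by (simp add: assms(2) reflect_poly_smult)
  then have "lead_coeff (f * reflect_poly f) = c * c * lead_coeff (f * reflect_poly f)"
    by (metis lead_coeff_smult)
  then have "c * c = 1" using assms(3) by (simp add: lead_coeff_mult)
  then have "c = 1 \<or> c = -1" by (simp add: square_eq_1_iff)
  then show ?thesis using assms(2) by auto
qed

lemma reducible_strip_lift_xy:
  fixes F W :: "int poly"
  assumes F: "F = (\<Sum>j\<in>I. monom (a j) (d j))" and d: "\<And>j. j \<in> I \<Longrightarrow> d j \<le> degree F"
    and F0: "coeff F 0 \<noteq> 0" and degF: "0 < degree F" and k: "0 < k"
    and W: "W * reflect_poly W = F * reflect_poly F" "coeff W 0 \<noteq> 0" "degree W = degree F"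
      "W \<noteq> F" "W \<noteq> - F" "W \<noteq> reflect_poly F" "W \<noteq> - reflect_poly F"
    and near_F: "\<And>j. j \<in> I \<Longrightarrow> near_multiple k E (d j)"
    and near_W: "\<And>i. coeff W i \<noteq> 0 \<Longrightarrow> near_multiple k E i"
  shows "reducible (strip_x (lift_xy k E a d I))"
proof (rule ccontr)
  assume not_red: "\<not> reducible (strip_x (lift_xy k E a d I))"
  define X :: "int poly" where "X = monom 1 k"
  define L where "L = (degree F + E) div k"
  define c where "c = E + k * L - degree F"
  define J where "J = {i. i \<le> degree W \<and> coeff W i \<noteq> 0}"
  define G where "G = lift_xy k E a d I"
  define G' where "G' = colift_xy k E L a d I"
  define H where "H = lift_xy k E (coeff W) (\<lambda>i. i) J"
  define H' where "H' = colift_xy k E L (coeff W) (\<lambda>i. i) J"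
  define P where "P = strip_x G"
  have "W = (\<Sum>i\<le>degree W. monom (coeff W i) i)" by (simp add: poly_as_sum_of_monoms)
  also have "\<dots> = (\<Sum>i\<in>J. monom (coeff W i) i)"
    unfolding J_def by (intro sum.mono_neutral_right) auto
  finally have W_sum: "W = (\<Sum>i\<in>J. monom (coeff W i) i)" .
  have nzW: "W \<noteq> 0" and nzF: "F \<noteq> 0" using W(2) F0 by auto
  have near_J: "near_multiple k E i" if "i \<in> J" for i using that near_W by (simp add: J_def)
  have near_deg: "near_multiple k E (degree W)" using near_W nzW by simp
  have evalG: "poly G X = monom 1 E * F" and evalH: "poly H X = monom 1 E * W"
    unfolding G_def H_def X_def poly_lift_xy by (simp_all flip: F W_sum)
  have evalG': "poly G' X = monom 1 c * reflect_poly F"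
    unfolding G'_def c_def X_def
    using near_deg W(3) by (intro poly_colift_xy[OF F d near_F]) (simp_all add: L_def)
  have evalH': "poly H' X = monom 1 c * reflect_poly W"
    unfolding H'_def c_def X_def W(3)[symmetric]
    using near_deg W(3)
    by (intro poly_colift_xy[OF W_sum _ near_J]) (simp_all add: L_def J_def)
  \<comment> \<open>The difference vanishes at \<open>y = x^k\<close> and has
    \<open>x\<close>-degree below \<open>k\<close>, where the substitution is injective.\<close>
  have "G * G' - H * H' = 0"
  proof (rule poly_monom_eq_0_imp_eq_0)
    show "degree (coeff (G * G' - H * H') v) < k" for v
      unfolding coeff_diff G_def G'_def H_def H'_def
      using near_F near_J k
      by (intro degree_diff_less degree_coeff_mult_less degree_coeff_lift_xy) auto
    have "poly (G * G' - H * H') X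
        = monom 1 E * monom 1 c * (F * reflect_poly F - W * reflect_poly W)"
      by (simp add: evalG evalG' evalH evalH' algebra_simps)
    then show "poly (G * G' - H * H') (monom 1 k) = 0" using W(1) by (simp add: X_def)
  qed
  then have prod: "G * G' = H * H'" by simp
  have nzG: "G \<noteq> 0" using evalG nzF by (metis mult_eq_0_iff monom_eq_0_iff one_neq_zero poly_0)
  obtain M where M: "G = monom_xy 1 M 0 * P" unfolding P_def by (rule strip_xE[OF nzG])
  have FP: "monom 1 E * F = monom 1 M * poly P X"
    using arg_cong[OF M, of "\<lambda>g. poly g X"] evalG by (simp add: X_def poly_monom_xy)
  \<comment> \<open>At \<open>y = x^k\<close>, \<open>P\<close> becomes \<open>F\<close> up to
    powers of \<open>x\<close>, and these cancel because \<open>F\<close> has a nonzero constant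
    term.\<close>
  have F_dvd: "F dvd f" if "poly P X dvd monom 1 m * f" for f m
  proof -
    have "F dvd monom 1 M * (monom 1 m * f)"
      by (metis FP dvd_trans dvd_triv_right mult_dvd_mono dvd_refl that)
    then show ?thesis using F0 by (blast intro: dvd_monom_mult_cancel)
  qed
  have "P \<noteq> 0" using M nzG by auto
  moreover have "\<not> P dvd 1"
  proof
    assume "P dvd 1"
    then obtain Q where "1 = P * Q" by blast
    then have "poly P X dvd monom 1 0 * 1"
      by (metis poly_1 poly_mult dvd_triv_left monom_eq_1 mult_1)
    then have "F dvd 1" by (rule F_dvd)
    then show False using degF dvd_imp_degree_le[of F 1] by simp
  qed
  ultimately have "irreducible P" using not_red by (simp add: reducible_def P_def G_def)
  then have "prime_elem P" by (rule irreducible_imp_prime_elem)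
  moreover have "P dvd H * H'" using M prod by (metis dvd_mult2 dvd_triv_right)
  ultimately consider "P dvd H" | "P dvd H'" by (auto simp: prime_elem_dvd_mult_iff)
  then show False
  proof cases
    case 1
    then have "poly P X dvd poly H X" by (metis dvdE dvd_triv_left poly_mult)
    then have "F dvd W" unfolding evalH by (rule F_dvd)
    then obtain s where "W = smult s F" using dvd_same_degree_constE W(3) nzW by blast
    then show False using reciprocal_product_smult_imp[OF W(1)] W(4,5) nzF by blast
  next
    case 2
    then have "poly P X dvd poly H' X" by (metis dvdE dvd_triv_left poly_mult)
    then have "F dvd reflect_poly W" unfolding evalH' by (rule F_dvd)
    moreover have "degree (reflect_poly W) = degree F" using W(2,3) by simp
    ultimately obtain s where "reflect_poly W = smult s F"
      using dvd_same_degree_constE nzW by (metis reflect_poly_eq_0_iff)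
    moreover have "reflect_poly W * reflect_poly (reflect_poly W) = F * reflect_poly F"
      using W(1,2) by (simp add: mult.commute)
    ultimately have "reflect_poly W = F \<or> reflect_poly W = - F"
      using reciprocal_product_smult_imp nzF by blast
    then have "W = reflect_poly F \<or> W = reflect_poly (- F)"
      using W(2) by (metis reflect_poly_reflect_poly)
    moreover have "reflect_poly (- F) = - reflect_poly F" using reflect_poly_smult[of "-1" F] by simp
    ultimately show False using W(6,7) by simp
  qed
qed

section \<open>Choosing \<open>k\<close> with all exponents close to its multiples\<close>

text \<open>Let \<open>t\<close> be the signed distance from \<open>m\<close> to
  \<open>p * k\<close>. Being an integer, it satisfies \<open>\<bar>t\<bar> \<le> e\<close>, so
  adding \<open>e\<close> makes it a nonnegative residue \<open>t + e \<le> 2 * e\<close>. Without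
  the shift, the residue is \<open>t\<close> or \<open>t + k\<close>, depending on the sign.\<close>

lemma near_multiple_of_close:
  fixes \<epsilon> :: real and p :: int
  assumes eps: "0 < \<epsilon>" "\<epsilon> \<le> 1 / 4" and close: "\<bar>real m - of_int p * real k\<bar> < \<epsilon> * real k"
  shows "near_multiple k (nat \<lfloor>\<epsilon> * real k\<rfloor>) m"
    and "real (m mod k) \<in> {0..<\<epsilon> * real k} \<union> {(1 - \<epsilon>) * real k<..<real k}"
proof -
  define t where "t = int m - p * int k"
  define e where "e = nat \<lfloor>\<epsilon> * real k\<rfloor>"
  have k: "0 < real k" using close eps
    by (metis abs_ge_zero less_le_trans not_le of_nat_0_le_iff order_le_less mult_zero_right)
  have ek: "\<epsilon> * real k \<le> real k / 4" using mult_right_mono[OF eps(2), of "real k"] k by simp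
  have t_real: "real_of_int t = real m - of_int p * real k" by (simp add: t_def)
  have t: "\<bar>real_of_int t\<bar> < \<epsilon> * real k" using close t_real by simp
  have e_int: "int e = \<lfloor>\<epsilon> * real k\<rfloor>" using eps k by (simp add: e_def)
  have e: "real e \<le> \<epsilon> * real k" using e_int by (metis of_int_floor_le of_int_of_nat_eq)
  have te: "\<bar>t\<bar> \<le> int e" unfolding e_int using t by (simp add: le_floor_iff)
  \<comment> \<open>This is where \<open>\<epsilon> \<le> 1 / 4\<close> enters: each of
    \<open>e\<close> and \<open>\<bar>t\<bar>\<close> is at most \<open>k / 4\<close>, the second
    strictly.\<close>
  have small: "real_of_int (int e + \<bar>t\<bar>) < real k / 2" using e t ek by simp
  then have "real_of_int (2 * (int e + \<bar>t\<bar>)) < real_of_int (int k)" by simp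
  then have small': "2 * (int e + \<bar>t\<bar>) < int k" by (simp only: of_int_less_iff)
  have "int ((m + e) mod k) = (t + int e + p * int k) mod int k"
    by (simp add: t_def of_nat_mod algebra_simps)
  also have "\<dots> = t + int e" using te small' by (simp add: mod_pos_pos_trivial)
  finally have m: "int ((m + e) mod k) = t + int e" .
  define v where "v = (m + e) mod k"
  have v: "int v = t + int e" using m by (simp add: v_def)
  have "int v \<le> int (2 * e)" "int (2 * v) < int k" using v te small' by simp_all
  then have "v \<le> 2 * e" "2 * v < k" by (simp_all only: of_nat_le_iff of_nat_less_iff)
  moreover from this have "int (2 * (2 * e - v)) < int k"
    using v te small' by (simp add: of_nat_diff)
  then have "2 * (2 * e - v) < k" by (simp only: of_nat_less_iff)
  ultimately show "near_multiple k (nat \<lfloor>\<epsilon> * real k\<rfloor>) m"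
    unfolding near_multiple_def e_def[symmetric] v_def by blast
  have *: "int (m mod k) = (t + p * int k) mod int k" by (simp add: t_def of_nat_mod)
  show "real (m mod k) \<in> {0..<\<epsilon> * real k} \<union> {(1 - \<epsilon>) * real k<..<real k}"
  proof (cases "t \<ge> 0")
    case True
    then have "int (m mod k) = t" using * small' by (simp add: mod_pos_pos_trivial)
    then have "real (m mod k) = real_of_int t" by (metis of_int_of_nat_eq)
    then show ?thesis using t by simp
  next
    case False
    have "int (m mod k) = (t + int k + (p - 1) * int k) mod int k" unfolding * by (simp add: algebra_simps)
    also have "\<dots> = (t + int k) mod int k" by (rule mod_mult_self1)
    also have "\<dots> = t + int k" using False te small' by (intro mod_pos_pos_trivial) auto
    finally have "real (m mod k) = real_of_int t + real k"
      by (metis of_int_add of_int_of_nat_eq)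
    then show ?thesis using t False by (simp add: algebra_simps)
  qed
qed

text \<open>Dirichlet approximation of the numbers \<open>s / n\<close> gives \<open>q\<close>, and \<open>k\<close> is \<open>n / q\<close> rounded up.
  The rounding moves \<open>s / k\<close> away from \<open>q s / n\<close> by at most \<open>q (q - 1) / n\<close>.\<close>

lemma simultaneously_close_to_multiples:
  fixes S :: "nat set" and \<epsilon> k\<^sub>0 :: real and K n :: nat
  assumes S: "finite S" "\<And>s. s \<in> S \<Longrightarrow> s \<le> n" and n: "0 < n" and K: "0 < K" "1 / real K < \<epsilon>"
    and large: "real (K ^ card S) * (real (K ^ card S) - 1) \<le> real n * (\<epsilon> - 1 / real K)"
    and k0: "0 \<le> k\<^sub>0" "k\<^sub>0 * real (K ^ card S) \<le> real n"
  obtains k where "k\<^sub>0 \<le> real k" "0 < k" "k \<le> n"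
    "\<And>s. s \<in> insert 0 (insert n S) \<Longrightarrow> \<exists>p. \<bar>real s - of_int p * real k\<bar> < \<epsilon> * real k"
proof -
  obtain h where h: "bij_betw h {..<card S} S"
    using ex_bij_betw_nat_finite[OF S(1)] by (auto simp: atLeast0LessThan)
  obtain qi p where q: "0 < qi" "qi \<le> int (K ^ card S)"
    "\<And>i. i < card S \<Longrightarrow> \<bar>of_int qi * (real (h i) / real n) - of_int (p i)\<bar> < 1 / real K"
    using Dirichlet_approx_simult[OF K(1), of "card S" "\<lambda>i. real (h i) / real n"] by blast
  define q where "q = nat qi"
  have qi: "qi = int q" using q(1) by (simp add: q_def)
  have q0: "0 < q" and qQ: "real q \<le> real (K ^ card S)"
    using q(1,2) unfolding qi by (simp, simp only: of_nat_le_iff)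
  define k where "k = nat \<lceil>real n / real q\<rceil>"
  have "-1 < real n / real q" by (rule less_le_trans[of _ 0]) simp_all
  then have k_int: "int k = \<lceil>real n / real q\<rceil>" by (simp add: k_def)
  have k_ge: "real n / real q \<le> real k" using k_int by (metis le_of_int_ceiling of_int_of_nat_eq)
  have "int k < real n / real q + 1" unfolding k_int by linarith
  then have k_lt: "real k < real n / real q + 1" by simp
  have k0': "0 < k" using k_ge n q0 by (metis divide_pos_pos less_le_trans of_nat_0_less_iff)
  have "real n / real q \<le> real n" using q0 n by (simp add: divide_le_eq)
  then have "int k \<le> int n" unfolding k_int by (simp add: ceiling_le_iff)
  then have kn: "k \<le> n" by simp
  have qk: "real n \<le> real q * real k" using k_ge q0 by (simp add: field_simps)
  have "real q * real k < real n + real q" using k_lt q0 by (simp add: field_simps)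
  \<comment> \<open>Integrality sharpens the rounding error \<open>q * k - n\<close> from below
    \<open>q\<close> to at most \<open>q - 1\<close>.\<close>
  then have "q * k < n + q" by (metis of_nat_add of_nat_less_iff of_nat_mult)
  then have "q * k + 1 \<le> n + q" by simp
  then have qk': "real q * real k - real n \<le> real q - 1" by (simp flip: of_nat_mult)
  have "k\<^sub>0 * real q \<le> real k * real q"
    using k0(2) mult_left_mono[OF qQ k0(1)] qk by (simp only: mult.commute[of "real k"])
  then have k0k: "k\<^sub>0 \<le> real k" using qk q0 by (simp add: mult.commute)
  define \<delta> where "\<delta> = \<epsilon> - 1 / real K"
  have \<delta>: "0 < \<delta>" using K by (simp add: \<delta>_def)
  have "real q * (real q - 1) \<le> real (K ^ card S) * (real (K ^ card S) - 1)"
    using qQ q0 by (intro mult_mono) auto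
  then have "real q * (real q - 1) \<le> real n * \<delta>" using large by (simp add: \<delta>_def)
  also have "\<dots> \<le> real q * real k * \<delta>" using qk \<delta> by (intro mult_right_mono) auto
  finally have q1: "real q - 1 \<le> real k * \<delta>" using q0 by (simp add: mult.assoc)
  have "\<exists>p. \<bar>real s - of_int p * real k\<bar> < \<epsilon> * real k" if s: "s \<in> insert 0 (insert n S)" for s
  proof -
    consider "s = 0" | "s = n" | "s \<in> S" using s by blast
    then show ?thesis
    proof cases
      case 1
      have "0 < \<epsilon> * real k" using K k0' by (metis divide_pos_pos mult_pos_pos of_nat_0_less_iff less_trans zero_less_one)
      then show ?thesis using 1 by (intro exI[of _ 0]) simp
    next
      \<comment> \<open>The multiplier \<open>q\<close> itself serves for \<open>n\<close>, so
        \<open>n\<close>, like 0, costs no dimension in the Dirichlet approximation.\<close>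
      case 2
      have "\<bar>real n - of_int (int q) * real k\<bar> \<le> real k * \<delta>" using qk qk' q1 by simp
      also have "\<dots> < \<epsilon> * real k" using K k0' by (simp add: \<delta>_def algebra_simps)
      finally show ?thesis using 2 by blast
    next
      case 3
      then obtain i where i: "i < card S" "s = h i" using h by (auto simp: bij_betw_def)
      have sn: "real s \<le> real n" using S(2) 3 by simp
      define y where "y = real q * real s / real n"
      have y: "\<bar>y - of_int (p i)\<bar> < 1 / real K"
        using q(3)[OF i(1)] by (simp add: y_def qi i(2))
      \<comment> \<open>Here \<open>z\<close> is the shift caused by rounding \<open>n / q\<close>
        up to \<open>k\<close>. It costs at most \<open>k * \<delta>\<close>, and the Dirichlet
        error takes the remaining \<open>k / K\<close> of the tolerance.\<close>
      define z where "z = (real s / real n) * (real q * real k - real n)"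
      have "y * real k - real s = z" using n by (simp add: y_def z_def field_simps)
      moreover have "0 \<le> z" unfolding z_def using qk by (intro mult_nonneg_nonneg) auto
      moreover have "z \<le> 1 * (real q - 1)"
        unfolding z_def using qk qk' sn n by (intro mult_mono) auto
      ultimately have "\<bar>real s - y * real k\<bar> \<le> real k * \<delta>" using q1 by (simp add: abs_le_iff)
      moreover have "\<bar>y * real k - of_int (p i) * real k\<bar> < real k * (1 / real K)"
      proof -
        have "\<bar>y * real k - of_int (p i) * real k\<bar> = real k * \<bar>y - of_int (p i)\<bar>"
          by (metis abs_mult abs_of_nat left_diff_distrib mult.commute)
        also have "\<dots> < real k * (1 / real K)" using y k0' by (intro mult_strict_left_mono) auto
        finally show ?thesis .
      qed
      ultimately have "\<bar>real s - of_int (p i) * real k\<bar> < real k * \<delta> + real k * (1 / real K)" by linarith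
      then show ?thesis by (intro exI[of _ "p i"]) (simp add: \<delta>_def algebra_simps)
    qed
  qed
  then show ?thesis using that k0k k0' kn by blast
qed

section \<open>Counting the exponents and combining the estimates\<close>

theorem theorem3:
  fixes F :: "int poly" and a :: "nat \<Rightarrow> int" and d :: "nat \<Rightarrow> nat" and r :: nat
    and \<epsilon> k\<^sub>0 N :: real and \<kappa> :: int
  assumes F: "F = (\<Sum>j\<le>r. monom (a j) (d j))"
    and d0: "d 0 = 0" and d_mono: "\<And>j. j < r \<Longrightarrow> d j < d (Suc j)"
    and a_ends: "a r * a 0 \<noteq> 0"
    and eps: "0 < \<epsilon>" "\<epsilon> \<le> 1 / 4"
    and k0: "k\<^sub>0 \<ge> 2"
    and kappa: "\<kappa> = \<lfloor>1 / \<epsilon>\<rfloor> + 1"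
    and N: "N = 2 * (poly_norm F)\<^sup>2 + 2 * real r - 5"
    and deg: "real (degree F) \<ge>
        max ((of_int \<kappa> powr (2 * N - 2)) / 2 * inverse (\<epsilon> - 1 / of_int \<kappa>))
            (k\<^sub>0 * (of_int \<kappa> powr (N - 1) + \<epsilon>))"
    and red: "reducible (nonreciprocal_part F)"
  shows "\<exists>k::nat. k\<^sub>0 \<le> real k \<and> real k < real (degree F) / (1 - \<epsilon>) \<and>
     (\<forall>j\<le>r. real (d j mod k) \<in> {0..<\<epsilon> * real k} \<union> {(1 - \<epsilon>) * real k<..<real k}) \<and>
     (let e = nat \<lfloor>\<epsilon> * real k\<rfloor>;
          dbar = (\<lambda>j. (d j + e) mod k);
          l = (\<lambda>j. (d j + e) div k);
          G = (\<Sum>j\<le>r. monom_xy (a j) (dbar j) (l j))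
      in reducible (strip_x G))"
proof -
  have d_less: "d i < d j" if "i < j" "j \<le> r" for i j
    using that
  proof (induction j)
    case (Suc j)
    then show ?case using d_mono[of j] by (cases "i = j") auto
  qed simp
  have d_eq_iff: "d i = d j \<longleftrightarrow> i = j" if "i \<le> r" "j \<le> r" for i j
    using that d_less by (metis nat_neq_iff)
  have coeff_F: "coeff F (d j) = a j" if "j \<le> r" for j
  proof -
    have "coeff F (d j) = (\<Sum>i\<le>r. if i = j then a i else 0)"
      unfolding F coeff_sum using d_eq_iff that by (intro sum.cong) auto
    then show ?thesis using that by simp
  qed
  have d_le: "d j \<le> d r" if "j \<le> r" for j
    using that d_less by (metis le_eq_less_or_eq)
  have "degree F \<le> d r"
    unfolding F using d_le by (intro degree_sum_le) (auto intro: order_trans[OF degree_monom_le])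
  moreover have "d r \<le> degree F" using a_ends coeff_F[of r] by (intro le_degree) auto
  ultimately have n: "degree F = d r" by simp
  have F0: "coeff F 0 \<noteq> 0" using a_ends coeff_F[of 0] d0 by auto
  have nzF: "F \<noteq> 0" using F0 by auto
  obtain W where W: "W * reflect_poly W = F * reflect_poly F" "coeff W 0 \<noteq> 0" "degree W = degree F"
      "W \<noteq> F" "W \<noteq> - F" "W \<noteq> reflect_poly F" "W \<noteq> - reflect_poly F"
    using reducible_nonreciprocal_part_imp_companion[OF F0 red] by blast
  have sq: "(\<Sum>i\<le>degree W. (coeff W i)\<^sup>2) = (\<Sum>i\<le>degree F. (coeff F i)\<^sup>2)"
    using W(1,3) by (metis coeff_mult_reflect_poly_degree)
  \<comment> \<open>Constants \<open>W\<close> and \<open>F\<close> with equal squares would agree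
    up to sign.\<close>
  have n0: "0 < degree F"
  proof (rule ccontr)
    assume "\<not> 0 < degree F"
    then have "W = [:coeff W 0:]" "F = [:coeff F 0:]" "(coeff W 0)\<^sup>2 = (coeff F 0)\<^sup>2"
      using W(3) sq degree_0_id[of W] degree_0_id[of F] by auto
    then show False using W(4,5) by (metis power2_eq_iff minus_pCons minus_zero)
  qed
  then have r: "0 < r" using n d0 by (cases r) auto

  define supp where "supp = {i. i \<le> degree W \<and> coeff W i \<noteq> 0}"
  \<comment> \<open>The exponents 0 and \<open>degree F\<close> are left out, since they are
    approximated for free; this keeps \<open>card S\<close> small.\<close>
  define S where "S = d ` {0<..<r} \<union> (supp - {0, degree F})"
  define c where "c = card S"
  have fin: "finite supp" by (simp add: supp_def)
  have "coeff W (degree F) \<noteq> 0" using W(2,3) by (metis coeff_0 leading_coeff_0_iff)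
  then have "{0, degree F} \<subseteq> supp" using W(2,3) by (auto simp: supp_def)
  then have "card (supp - {0, degree F}) = card supp - 2" "2 \<le> card supp"
    using fin n0 card_mono[OF fin, of "{0, degree F}"] by (simp_all add: card_Diff_subset)
  moreover have "card (d ` {0<..<r}) \<le> r - 1" using card_image_le[of "{0<..<r}" d] by simp
  \<comment> \<open>There are at most \<open>r - 1\<close> inner exponents of \<open>F\<close> and
    \<open>card supp - 2\<close> of \<open>W\<close>. Doubling the bound gives
    \<open>2 * c \<le> N - 1\<close>, where the 5 in \<open>N\<close> becomes 6.\<close>
  ultimately have "c + 3 \<le> r + card supp"
    using card_Un_le[of "d ` {0<..<r}" "supp - {0, degree F}"] r unfolding c_def S_def by linarith
  moreover have "real (card supp) \<le> (poly_norm F)\<^sup>2"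
    using card_support_le_sum_squares[of W] unfolding supp_def sq poly_norm_square_eq
    by (metis of_int_le_iff of_int_of_nat_eq)
  ultimately have cN: "2 * real c \<le> N - 1" unfolding N by linarith

  define K where "K = nat \<kappa>"
  have "1 \<le> 1 / \<epsilon>" using eps by simp
  then have kappa1: "1 < \<kappa>" and kappa_eps: "1 / \<epsilon> < of_int \<kappa>" unfolding kappa by linarith+
  have K: "real K = of_int \<kappa>" "1 < K" using kappa1 by (auto simp: K_def)
  have K_eps: "1 / real K < \<epsilon>"
    using kappa_eps eps K by (simp add: field_simps)
  define Q where "Q = real (K ^ c)"
  have Q1: "1 \<le> Q" using K(2) by (simp add: Q_def)
  have powr_K: "of_int \<kappa> powr real m = real K ^ m" for m
    using K by (simp add: powr_realpow flip: K(1))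
  have powr_Q: "of_int \<kappa> powr (2 * real c) = Q\<^sup>2" "of_int \<kappa> powr (4 * real c) = Q ^ 4"
    using powr_K[of "c * 2"] powr_K[of "c * 4"]
    by (simp_all add: Q_def mult.commute flip: power_mult)
  have "Q ^ 4 \<le> of_int \<kappa> powr (2 * N - 2)" "Q\<^sup>2 \<le> of_int \<kappa> powr (N - 1)"
    unfolding powr_Q[symmetric] using kappa1 cN by (auto intro!: powr_mono)
  note Q = this
  \<comment> \<open>The approximation asks for \<open>Q * (Q - 1)\<close>, whereas the degree
    hypothesis supplies \<open>Q ^ 4 / 2\<close>, because
    \<open>4 * c \<le> 2 * N - 2\<close>.\<close>
  have "Q * (Q - 1) \<le> Q ^ 4 / 2"
  proof -
    have "2 * (Q * (Q - 1)) \<le> Q ^ 4"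
    proof -
      have "0 \<le> (Q\<^sup>2 - 1)\<^sup>2 " by simp
      moreover have "(Q\<^sup>2 - 1)\<^sup>2 = Q ^ 4 - 2 * Q\<^sup>2 + 1" by (simp add: power2_eq_square power4_eq_xxxx algebra_simps)
      ultimately have "2 * Q\<^sup>2 - 1 \<le> Q ^ 4" by simp
      then show ?thesis using Q1 by (simp add: power2_eq_square algebra_simps)
    qed
    then show ?thesis by simp
  qed
  moreover have "Q ^ 4 / 2 \<le> real (degree F) * (\<epsilon> - 1 / real K)"
  proof -
    have "of_int \<kappa> powr (2 * N - 2) / 2 * inverse (\<epsilon> - 1 / real K) \<le> real (degree F)"
      using deg by (simp add: K(1))
    then have "of_int \<kappa> powr (2 * N - 2) / 2 \<le> real (degree F) * (\<epsilon> - 1 / real K)"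
      using K_eps by (simp add: field_simps)
    then show ?thesis using Q(1) by simp
  qed
  ultimately have large: "Q * (Q - 1) \<le> real (degree F) * (\<epsilon> - 1 / real K)" by linarith
  have "k\<^sub>0 * Q \<le> k\<^sub>0 * (of_int \<kappa> powr (N - 1) + \<epsilon>)"
  proof (rule mult_left_mono)
    have "Q \<le> Q\<^sup>2" using Q1 by (simp add: power2_eq_square)
    then show "Q \<le> of_int \<kappa> powr (N - 1) + \<epsilon>" using Q(2) eps(1) by linarith
  qed (use k0 in simp)
  then have k0Q: "k\<^sub>0 * Q \<le> real (degree F)" using deg by simp

  have finS: "finite S" using fin by (simp add: S_def)
  have S_le: "s \<le> degree F" if "s \<in> S" for s
    using that d_le W(3) by (auto simp: S_def supp_def n)
  obtain k where k: "k\<^sub>0 \<le> real k" "0 < k" "k \<le> degree F"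
    "\<And>s. s \<in> insert 0 (insert (degree F) S)
      \<Longrightarrow> \<exists>p. \<bar>real s - of_int p * real k\<bar> < \<epsilon> * real k"
    using simultaneously_close_to_multiples[OF finS S_le n0 _ K_eps, of k\<^sub>0] K(2) k0
      large k0Q unfolding Q_def c_def by auto
  define e where "e = nat \<lfloor>\<epsilon> * real k\<rfloor>"
  have close_d: "\<exists>p. \<bar>real (d j) - of_int p * real k\<bar> < \<epsilon> * real k" if "j \<le> r" for j
  proof -
    have "j = 0 \<or> j = r \<or> j \<in> {0<..<r}" using that by auto
    then show ?thesis using d0 n by (intro k(4)) (auto simp: S_def)
  qed
  have close_W: "\<exists>p. \<bar>real i - of_int p * real k\<bar> < \<epsilon> * real k" if "coeff W i \<noteq> 0" for i
    using that le_degree[OF that] by (intro k(4)) (auto simp: S_def supp_def)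
  have red: "reducible (strip_x (lift_xy k e a d {..r}))"
  proof (rule reducible_strip_lift_xy[OF F _ F0 n0 k(2) W])
    show "d j \<le> degree F" if "j \<in> {..r}" for j using that d_le n by simp
    show "near_multiple k e (d j)" if "j \<in> {..r}" for j
      using that close_d near_multiple_of_close(1)[OF eps] unfolding e_def by blast
    show "near_multiple k e i" if "coeff W i \<noteq> 0" for i
      using that close_W near_multiple_of_close(1)[OF eps] unfolding e_def by blast
  qed
  have "real k < real (degree F) / (1 - \<epsilon>)"
  proof -
    have "real k * (1 - \<epsilon>) < real k * 1" using k(2) eps(1) by (intro mult_strict_left_mono) auto
    then have "real k * (1 - \<epsilon>) < real (degree F)" using k(3) by simp
    then show ?thesis using eps by (simp add: field_simps)
  qed
  moreover have "\<forall>j\<le>r. real (d j mod k) \<in> {0..<\<epsilon> * real k} \<union> {(1 - \<epsilon>) * real k<..<real k}"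
    using close_d near_multiple_of_close(2)[OF eps] by blast
  ultimately show ?thesis
    using k(1) red unfolding lift_xy_def e_def Let_def by blast
qed

end
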